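(* Let $m\ge 0$ be an integer and let $\omega_1,\dots,\omega_{2m+2}\in S\oplus V$ be linearly independent over $\mathbb{R}$. Let $\zeta=\zeta_{2m+2}$ be the Weierstrass-type zeta function of the lattice $2\mathbb{Z}\omega_1+\cdots+2\mathbb{Z}\omega_{2m+2}$. Define $$C(x)=\Big[\prod_{j=1}^{2m+2}(I-E_j)\Big](\zeta)(x).$$ Then for any fixed $k\in\{1,\dots,2m+2\}$, the paravectors $\omega_i+\omega_k$, $i=1,\dots,2m+2$ (including $2\omega_k$ for $i=k$), are periods of $C$; that is, $C(x+\omega_i+\omega_k)=C(x)$ for every $x\in (S\oplus V)\setminus(\mathbb{Z}\omega_1+\cdots+\mathbb{Z}\omega_{2m+2})$ and every $i\in\{1,\dots,2m+2\}$.
   Context: $\mathbb{R}_{0,2m+1}$ is the real Clifford algebra of the vector space $V=\mathbb{R}^{2m+1}$ with negative definite quadratic form: it is generated by an orthonormal basis $e_1,\dots,e_{2m+1}$ of $V$ with $e_ie_j+e_je_i=-2\delta_{ij}$ for $1\le i,j\le 2m+1$; $S\cong\mathbb{R}$ denotes the scalars. Elements $x=x_0+\sum_{i=1}^{2m+1}x_ie_i$ of $S\oplus V\cong\mathbb{R}^{2m+2}$ are called paravectors; every nonzero paravector is invertible in $\mathbb{R}_{0,2m+1}$, with inverse a paravector. Zeta function: for $N\in\{1,\dots,2m+2\}$ and $\mathbb{R}$-linearly independent paravectors $\omega_1,\dots,\omega_N$ (half periods), enumerate the lattice $2\mathbb{Z}\omega_1+\cdots+2\mathbb{Z}\omega_N$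 as $\{w_p\}_{p\ge 0}$ with $w_0=0$, and for $x\in S\oplus V$ not in this lattice set $$\zeta_N(x)=x^{-1}+\sum_{p=1}^\infty\Big\{(x-w_p)^{-1}+\sum_{\mu=0}^{N-1}(w_p^{-1}x)^\mu w_p^{-1}\Big\}\in\mathbb{R}_{0,2m+1}.$$ Translation operators: for a function $\varphi$ on $S\oplus V$ (possibly with isolated singularities) with values in $\mathbb{R}_{0,2m+1}$, $I$ is the identity operator and $E_j(\varphi)(x)=\varphi(x+\omega_j)$. These operators commute; products denote composition. *)

theory Defs
  imports "HOL-Analysis.Analysis"
begin

section \<open>The real Clifford algebra of a negative definite form\<close>

text \<open>
  The generators are indexed by a finite linearly ordered type \<open>'n\<close>, so that \<open>'n clifford\<close> is the
  Clifford algebra of \<open>\<real>\<^sup>n\<close>, \<open>n = CARD('n)\<close>. An element is given by its coordinates with respect to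
  the basis \<open>e\<^sub>A = e\<^bsub>a1\<^esub> \<cdots> e\<^bsub>ar\<^esub>\<close>, for \<open>A = {a1 < \<dots> < ar}\<close>.
\<close>

typedef 'n clifford = "UNIV :: ('n set \<Rightarrow> real) set"
  morphisms coord Cliff ..

lemma coord_Cliff [simp]: "coord (Cliff f) = f"
  by (simp add: Cliff_inverse)

lemma clifford_eq_iff: "x = y \<longleftrightarrow> (\<forall>A. coord x A = coord y A)"
  by (metis coord_inverse ext)

text \<open>
  Reordering \<open>e\<^sub>A e\<^sub>B\<close> takes one transposition for every \<open>a \<in> A\<close>, \<open>b \<in> B\<close> with \<open>b < a\<close>, and one
  application of \<open>e\<^sub>a\<^sup>2 = -1\<close> for every \<open>a \<in> A \<inter> B\<close>.
\<close>

definition blade_sign :: "'n::linorder set \<Rightarrow> 'n set \<Rightarrow> real" where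
  "blade_sign A B = (-1) ^ card {(a, b). a \<in> A \<and> b \<in> B \<and> b \<le> a}"

lemma blade_sign_prod:
  fixes A B :: "'n::{finite,linorder} set"
  shows "blade_sign A B = (\<Prod>a\<in>A. \<Prod>b\<in>B. if b \<le> a then -1 else 1)"
proof -
  have "(\<Prod>a\<in>A. \<Prod>b\<in>B. if b \<le> a then -1 else 1)
      = (\<Prod>(a,b)\<in>A \<times> B. if b \<le> a then -1 else (1::real))"
    by (simp add: prod.cartesian_product)
  also have "\<dots> = (\<Prod>p\<in>{(a, b). a \<in> A \<and> b \<in> B \<and> b \<le> a}. -1)"
    by (rule prod.mono_neutral_cong_right) (auto split: if_splits)
  finally show ?thesis by (simp add: blade_sign_def)
qed

lemma prod_sym_diff:
  fixes f :: "'a::finite \<Rightarrow> real"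
  assumes "\<And>a. f a * f a = 1"
  shows "prod f (sym_diff A B) = prod f A * prod f B"
proof -
  have "prod f A = prod f (A - B) * prod f (A \<inter> B)"
    by (metis finite inf_commute mult.commute prod.Int_Diff)
  moreover have "prod f B = prod f (B - A) * prod f (A \<inter> B)"
    by (metis finite inf_commute mult.commute prod.Int_Diff)
  moreover have "prod f (A \<inter> B) * prod f (A \<inter> B) = 1"
    by (simp add: assms flip: prod.distrib)
  moreover have "prod f (sym_diff A B) = prod f (A - B) * prod f (B - A)"
    by (rule prod.union_disjoint) auto
  ultimately show ?thesis by (simp add: algebra_simps)
qed

lemma blade_sign_sym_diff_left:
  fixes A B C :: "'n::{finite,linorder} set"
  shows "blade_sign (sym_diff A B) C = blade_sign A C * blade_sign B C"
  unfolding blade_sign_prod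
  by (rule prod_sym_diff) (auto simp flip: prod.distrib intro!: prod.neutral)

lemma blade_sign_sym_diff_right:
  fixes A B C :: "'n::{finite,linorder} set"
  shows "blade_sign A (sym_diff B C) = blade_sign A B * blade_sign A C"
  unfolding blade_sign_prod prod.distrib [symmetric]
  by (rule prod.cong[OF refl], rule prod_sym_diff) simp

lemma blade_sign_empty [simp]: "blade_sign {} A = 1" "blade_sign A {} = 1"
  by (simp_all add: blade_sign_def)

lemma sym_diff_cancel_left: "sym_diff A (sym_diff A B) = B"
  by blast

lemma bij_sym_diff: "bij (sym_diff A)"
  by (rule o_bij[where g = "sym_diff A"]) (simp_all add: fun_eq_iff sym_diff_cancel_left)

instantiation clifford :: (type) real_vector
begin

definition "0 = Cliff (\<lambda>A. 0)"
definition "x + y = Cliff (\<lambda>A. coord x A + coord y A)"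
definition "x - y = Cliff (\<lambda>A. coord x A - coord y A)"
definition "- x = Cliff (\<lambda>A. - coord x A)"
definition "r *\<^sub>R x = Cliff (\<lambda>A. r * coord x A)"

instance
  by standard (simp_all add: clifford_eq_iff zero_clifford_def plus_clifford_def
      minus_clifford_def uminus_clifford_def scaleR_clifford_def algebra_simps)

end

lemma coord_simps [simp]:
  "coord 0 A = 0"
  "coord (x + y) A = coord x A + coord y A"
  "coord (x - y) A = coord x A - coord y A"
  "coord (- x) A = - coord x A"
  "coord (r *\<^sub>R x) A = r * coord x A"
  by (simp_all add: zero_clifford_def plus_clifford_def minus_clifford_def
      uminus_clifford_def scaleR_clifford_def)

lemma coord_sum [simp]: "coord (sum f I) A = (\<Sum>i\<in>I. coord (f i) A)"
  by (induction I rule: infinite_finite_induct) simp_all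

instantiation clifford :: ("{finite,linorder}") real_algebra_1
begin

definition "1 = Cliff (\<lambda>A. if A = {} then 1 else 0)"
definition "x * y = Cliff (\<lambda>C. \<Sum>A\<in>UNIV.
  blade_sign A (sym_diff A C) * (coord x A * coord y (sym_diff A C)))"

instance
proof
  fix x y z :: "'a clifford" and r :: real
  show "(x * y) * z = x * (y * z)"
  proof -
    have "coord ((x * y) * z) D = coord (x * (y * z)) D" for D
    proof -
      have sgn: "blade_sign C (sym_diff C D) * blade_sign A (sym_diff A C)
          = blade_sign A (sym_diff A D) * blade_sign (sym_diff A C) (sym_diff C D)"
        for A C
      proof -
        have CD: "sym_diff A D = sym_diff (sym_diff A C) (sym_diff C D)" by blast
        have AC: "sym_diff A (sym_diff A C) = C" by blast
        have "blade_sign C (sym_diff C D)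
            = blade_sign A (sym_diff C D) * blade_sign (sym_diff A C) (sym_diff C D)"
          using blade_sign_sym_diff_left[of A "sym_diff A C" "sym_diff C D"] by (simp only: AC)
        moreover have "blade_sign A (sym_diff A D)
            = blade_sign A (sym_diff A C) * blade_sign A (sym_diff C D)"
          by (subst CD) (rule blade_sign_sym_diff_right)
        ultimately show ?thesis by simp
      qed
      have "coord (x * (y * z)) D = (\<Sum>A\<in>UNIV. \<Sum>B\<in>UNIV.
          blade_sign A (sym_diff A D) * (coord x A *
          (blade_sign B (sym_diff B (sym_diff A D)) *
            (coord y B * coord z (sym_diff B (sym_diff A D))))))"
        by (simp add: times_clifford_def sum_distrib_left)
      also have "\<dots> = (\<Sum>A\<in>UNIV. \<Sum>C\<in>UNIV.
          blade_sign A (sym_diff A D) * (coord x A *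
          (blade_sign (sym_diff A C) (sym_diff C D) *
            (coord y (sym_diff A C) * coord z (sym_diff C D)))))"
      proof (rule sum.cong[OF refl])
        fix A :: "'a set"
        have eq: "sym_diff (sym_diff A C) (sym_diff A D) = sym_diff C D" for C
          by blast
        show "(\<Sum>B\<in>UNIV. blade_sign A (sym_diff A D) * (coord x A *
          (blade_sign B (sym_diff B (sym_diff A D)) *
            (coord y B * coord z (sym_diff B (sym_diff A D))))))
          = (\<Sum>C\<in>UNIV. blade_sign A (sym_diff A D) * (coord x A *
          (blade_sign (sym_diff A C) (sym_diff C D) *
            (coord y (sym_diff A C) * coord z (sym_diff C D)))))"
          using sum.reindex_bij_betw[OF bij_sym_diff[of A], symmetric,
              of "\<lambda>B. blade_sign A (sym_diff A D) * (coord x A *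
          (blade_sign B (sym_diff B (sym_diff A D)) *
            (coord y B * coord z (sym_diff B (sym_diff A D)))))"]
          by (simp only: eq)
      qed
      also have "\<dots> = (\<Sum>A\<in>UNIV. \<Sum>C\<in>UNIV.
          blade_sign C (sym_diff C D) * ((blade_sign A (sym_diff A C) *
            (coord x A * coord y (sym_diff A C))) * coord z (sym_diff C D)))"
      proof (intro sum.cong refl)
        fix A C :: "'a set"
        have "blade_sign A (sym_diff A D) * (a * (blade_sign (sym_diff A C) (sym_diff C D) * (b * c)))
            = (blade_sign A (sym_diff A D) * blade_sign (sym_diff A C) (sym_diff C D)) * (a * (b * c))"
          for a b c :: real by (simp only: mult.assoc mult.left_commute)
        then show "blade_sign A (sym_diff A D) * (coord x A *
            (blade_sign (sym_diff A C) (sym_diff C D) *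
              (coord y (sym_diff A C) * coord z (sym_diff C D))))
          = blade_sign C (sym_diff C D) * ((blade_sign A (sym_diff A C) *
            (coord x A * coord y (sym_diff A C))) * coord z (sym_diff C D))"
          by (simp only: sgn [symmetric] mult.assoc)
      qed
      also have "\<dots> = (\<Sum>C\<in>UNIV. \<Sum>A\<in>UNIV.
          blade_sign C (sym_diff C D) * ((blade_sign A (sym_diff A C) *
            (coord x A * coord y (sym_diff A C))) * coord z (sym_diff C D)))"
        by (rule sum.swap)
      also have "\<dots> = coord ((x * y) * z) D"
        by (simp add: times_clifford_def sum_distrib_left sum_distrib_right)
      finally show ?thesis by simp
    qed
    then show ?thesis by (simp add: clifford_eq_iff)
  qed
  show "1 * x = x"
  proof -
    have "coord (1 * x) C = coord x C" for C
    proof -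
      have "coord (1 * x) C = (\<Sum>A\<in>{{}}.
          blade_sign A (sym_diff A C) * (coord 1 A * coord x (sym_diff A C)))"
        unfolding times_clifford_def one_clifford_def coord_Cliff
        by (rule sum.mono_neutral_right) auto
      then show ?thesis by (simp add: one_clifford_def)
    qed
    then show ?thesis by (simp add: clifford_eq_iff)
  qed
  show "x * 1 = x"
  proof -
    have "coord (x * 1) C = coord x C" for C
    proof -
      have "coord (x * 1) C = (\<Sum>A\<in>{C}.
          blade_sign A (sym_diff A C) * (coord x A * coord 1 (sym_diff A C)))"
        unfolding times_clifford_def one_clifford_def coord_Cliff
        by (rule sum.mono_neutral_right) auto
      then show ?thesis by (simp add: one_clifford_def)
    qed
    then show ?thesis by (simp add: clifford_eq_iff)
  qed
  show "(x + y) * z = x * z + y * z" "x * (y + z) = x * y + x * z"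
    "(r *\<^sub>R x) * y = r *\<^sub>R (x * y)" "x * (r *\<^sub>R y) = r *\<^sub>R (x * y)"
    by (simp_all add: clifford_eq_iff times_clifford_def algebra_simps sum.distrib
        sum_distrib_left)
  show "(0 :: 'a clifford) \<noteq> 1"
    by (auto simp: clifford_eq_iff one_clifford_def)
qed

end

text \<open>The Euclidean structure in which the blades \<open>e\<^sub>A\<close> are orthonormal; it only serves to provide
  the topology of this finite-dimensional space.\<close>

definition blade :: "'n set \<Rightarrow> 'n clifford" where
  "blade A = Cliff (\<lambda>B. if B = A then 1 else 0)"

instantiation clifford :: (finite) euclidean_space
begin

definition inner_clifford_def: "inner x y = (\<Sum>A\<in>UNIV. coord x A * coord y A)"
definition norm_clifford_def: "norm (x :: 'a clifford) = sqrt (inner x x)"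
definition sgn_clifford_def: "sgn (x :: 'a clifford) = x /\<^sub>R norm x"
definition dist_clifford_def: "dist (x :: 'a clifford) y = norm (x - y)"
definition uniformity_clifford_def:
  "(uniformity :: ('a clifford \<times> 'a clifford) filter)
     = (INF e\<in>{0 <..}. principal {(x, y). dist x y < e})"
definition open_clifford_def:
  "open (U :: 'a clifford set)
     \<longleftrightarrow> (\<forall>x\<in>U. eventually (\<lambda>(x', y). x' = x \<longrightarrow> y \<in> U) uniformity)"
definition Basis_clifford_def: "Basis = range (blade :: 'a set \<Rightarrow> 'a clifford)"

instance
proof
  fix x y z :: "'a clifford" and r :: real and u v :: "'a clifford"
  show "inner x y = inner y x"
    by (simp add: inner_clifford_def mult.commute)
  show "inner (x + y) z = inner x z + inner y z" "inner (r *\<^sub>R x) y = r * inner x y"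
    by (simp_all add: inner_clifford_def algebra_simps sum.distrib sum_distrib_left)
  show "0 \<le> inner x x"
    by (simp add: inner_clifford_def sum_nonneg)
  show "inner x x = 0 \<longleftrightarrow> x = 0"
    by (simp add: inner_clifford_def sum_nonneg_eq_0_iff clifford_eq_iff)
  show "finite (Basis :: 'a clifford set)" "(Basis :: 'a clifford set) \<noteq> {}"
    by (simp_all add: Basis_clifford_def)
  have inner_blade: "inner w (blade A) = coord w A" for w :: "'a clifford" and A
  proof -
    have "inner w (blade A) = (\<Sum>B\<in>UNIV. if B = A then coord w B else 0)"
      unfolding inner_clifford_def blade_def by (intro sum.cong) auto
    then show ?thesis by simp
  qed
  show "inner u v = (if u = v then 1 else 0)"
    if uv: "u \<in> Basis" "v \<in> Basis"
  proof -
    obtain A B where AB: "u = blade A" "v = blade B"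
      using uv by (auto simp: Basis_clifford_def)
    have uv_coord: "inner u v = (if A = B then 1 else 0)"
      unfolding AB(2) inner_blade by (simp add: AB(1) blade_def)
    show ?thesis
    proof (cases "A = B")
      case True
      then show ?thesis using AB uv_coord by simp
    next
      case False
      then have "coord u A \<noteq> coord v A" by (simp add: AB blade_def)
      then have "u \<noteq> v" by blast
      then show ?thesis using False uv_coord by simp
    qed
  qed
  show "(\<forall>u\<in>Basis. inner x u = 0) \<longleftrightarrow> x = 0"
    by (simp add: Basis_clifford_def inner_blade clifford_eq_iff)
qed (rule norm_clifford_def sgn_clifford_def dist_clifford_def uniformity_clifford_def
      open_clifford_def)+

end

abbreviation gen :: "'n \<Rightarrow> 'n clifford" where
  "gen i \<equiv> blade {i}"

lemma blade_mult:
  fixes A B :: "'n::{finite,linorder} set"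
  shows "blade A * blade B = blade_sign A B *\<^sub>R blade (sym_diff A B)"
proof -
  have "coord (blade A * blade B) C = coord (blade_sign A B *\<^sub>R blade (sym_diff A B)) C" for C
  proof -
    have "coord (blade A * blade B) C = (\<Sum>D\<in>{A}.
        blade_sign D (sym_diff D C) * (coord (blade A) D * coord (blade B) (sym_diff D C)))"
      unfolding times_clifford_def blade_def coord_Cliff
      by (rule sum.mono_neutral_right) auto
    moreover have "sym_diff A C = B \<longleftrightarrow> C = sym_diff A B" by blast
    ultimately show ?thesis by (auto simp: blade_def)
  qed
  then show ?thesis by (simp add: clifford_eq_iff)
qed

lemma blade_empty: "blade {} = (1 :: 'n::{finite,linorder} clifford)"
  by (simp add: blade_def one_clifford_def)

theorem gen_anticommute:
  fixes i j :: "'n::{finite,linorder}"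
  shows "gen i * gen j + gen j * gen i = (if i = j then - 2 else 0)"
proof -
  have s: "blade_sign {a} {b} = (if b \<le> a then -1 else 1)" for a b :: 'n
    by (simp add: blade_sign_prod)
  show ?thesis
  proof (cases "i = j")
    case True
    then show ?thesis by (simp add: blade_mult s blade_empty)
  next
    case False
    have "sym_diff {i} {j} = sym_diff {j} {i}" by blast
    with False show ?thesis
      by (cases "i < j") (auto simp add: blade_mult s)
  qed
qed

theorem blade_insert:
  fixes a :: "'n::{finite,linorder}"
  assumes "\<And>b. b \<in> A \<Longrightarrow> a < b"
  shows "blade (insert a A) = gen a * blade A"
proof -
  have "a \<notin> A" using assms by blast
  then have "sym_diff {a} A = insert a A" by blast
  moreover have "blade_sign {a} A = 1"
    using assms by (auto simp: blade_sign_prod not_le intro!: prod.neutral)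
  ultimately show ?thesis by (simp add: blade_mult)
qed


section \<open>Paravectors and inverses\<close>

definition paravectors :: "'n::{finite,linorder} clifford set" where
  "paravectors = {of_real x0 + (\<Sum>i\<in>UNIV. v i *\<^sub>R gen i) | x0 v. True}"

definition cliff_inverse :: "'n::{finite,linorder} clifford \<Rightarrow> 'n clifford" where
  "cliff_inverse x = (THE y. x * y = 1 \<and> y * x = 1)"

lemma cliff_inverse_eqI:
  assumes "x * y = 1" "y * x = 1"
  shows "cliff_inverse x = y"
  unfolding cliff_inverse_def
proof (rule the_equality)
  show "z = y" if "x * z = 1 \<and> z * x = 1" for z
    by (metis assms(2) mult.assoc mult.left_neutral mult.right_neutral that)
qed (use assms in simp)

lemma vector_square:
  fixes v :: "'n::{finite,linorder} \<Rightarrow> real"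
  defines "V \<equiv> \<Sum>i\<in>UNIV. v i *\<^sub>R gen i"
  shows "V * V = of_real (- (\<Sum>i\<in>UNIV. (v i)\<^sup>2))"
proof -
  have VV: "V * V = (\<Sum>i\<in>UNIV. \<Sum>j\<in>UNIV. (v i * v j) *\<^sub>R (gen i * gen j))"
    unfolding V_def by (simp add: sum_product algebra_simps)
  also have "\<dots> = (\<Sum>i\<in>UNIV. \<Sum>j\<in>UNIV. (v i * v j) *\<^sub>R (gen j * gen i))"
    by (subst sum.swap) (simp add: mult.commute)
  finally have "V * V + V * V = (\<Sum>i\<in>UNIV. \<Sum>j\<in>UNIV.
      (v i * v j) *\<^sub>R (gen i * gen j + gen j * gen i))"
    using VV by (simp add: scaleR_add_right sum.distrib)
  also have "\<dots> = (\<Sum>i\<in>UNIV. (v i * v i) *\<^sub>R (- 2))"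
    by (simp add: gen_anticommute if_distrib cong: if_cong)
  also have "\<dots> = 2 *\<^sub>R of_real (- (\<Sum>i\<in>UNIV. (v i)\<^sup>2))"
    by (simp add: power2_eq_square scaleR_conv_of_real sum_negf flip: sum_distrib_right)
       (metis mult_2 mult_2_right)
  finally have "2 *\<^sub>R (V * V) = 2 *\<^sub>R of_real (- (\<Sum>i\<in>UNIV. (v i)\<^sup>2))"
    by (simp add: scaleR_2)
  then show ?thesis by (simp only: scaleR_cancel_left) simp
qed

lemma paravector_inverse:
  assumes "x \<in> paravectors" "x \<noteq> 0"
  shows "x * cliff_inverse x = 1" "cliff_inverse x * x = 1" "cliff_inverse x \<in> paravectors"
proof -
  obtain a v where x: "x = of_real a + (\<Sum>i\<in>UNIV. v i *\<^sub>R gen i)"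
    using assms(1) by (auto simp: paravectors_def)
  define V where "V = (\<Sum>i\<in>UNIV. v i *\<^sub>R gen i)"
  define q where "q = a\<^sup>2 + (\<Sum>i\<in>UNIV. (v i)\<^sup>2)"
  have "q \<noteq> 0"
  proof
    assume "q = 0"
    moreover have "0 \<le> (\<Sum>i\<in>UNIV. (v i)\<^sup>2)" by (simp add: sum_nonneg)
    ultimately have "a\<^sup>2 = 0" "(\<Sum>i\<in>UNIV. (v i)\<^sup>2) = 0"
      unfolding q_def using zero_le_power2[of a] by linarith+
    then have "a = 0" "\<And>i. v i = 0" by (simp_all add: sum_nonneg_eq_0_iff)
    then show False using assms(2) by (simp add: x)
  qed
  have VV: "V * V = of_real (- (\<Sum>i\<in>UNIV. (v i)\<^sup>2))"
    unfolding V_def by (rule vector_square)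
  have aV: "of_real a * V = V * of_real a"
    by (metis mult_scaleR_left mult_scaleR_right mult.left_neutral mult.right_neutral of_real_def)
  define y where "y = (1 / q) *\<^sub>R (of_real a - V)"
  have xV: "x = of_real a + V" by (simp add: x V_def)
  have "(of_real a + V) * (of_real a - V) = of_real q"
       "(of_real a - V) * (of_real a + V) = of_real q"
    using aV VV by (simp_all add: algebra_simps q_def power2_eq_square)
  then have xy: "x * y = 1" "y * x = 1"
    using \<open>q \<noteq> 0\<close> by (simp_all add: y_def xV of_real_def)
  then have "cliff_inverse x = y" by (rule cliff_inverse_eqI)
  moreover have "y = of_real (a / q) + (\<Sum>i\<in>UNIV. (- v i / q) *\<^sub>R gen i)"
    by (simp add: y_def V_def scaleR_diff_right scaleR_sum_right sum_negf of_real_def)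
  then have "y \<in> paravectors"
    unfolding paravectors_def mem_Collect_eq
    by (intro exI[of _ "a / q"] exI[of _ "\<lambda>i. - v i / q"]) simp
  ultimately show "x * cliff_inverse x = 1" "cliff_inverse x * x = 1"
    "cliff_inverse x \<in> paravectors"
    using xy by simp_all
qed


section \<open>Lattices, the zeta function and the translation operators\<close>

definition int_span :: "nat \<Rightarrow> (nat \<Rightarrow> 'a::real_vector) \<Rightarrow> 'a set" where
  "int_span N \<omega> = {\<Sum>j=1..N. of_int (k j) *\<^sub>R \<omega> j | k :: nat \<Rightarrow> int. True}"

definition lattice_enumeration :: "(nat \<Rightarrow> 'a::zero) \<Rightarrow> 'a set \<Rightarrow> bool" where
  "lattice_enumeration w L \<longleftrightarrow> bij_betw w UNIV L \<and> w 0 = 0"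

definition weierstrass_zeta ::
  "nat \<Rightarrow> (nat \<Rightarrow> 'n::{finite,linorder} clifford) \<Rightarrow> 'n clifford \<Rightarrow> 'n clifford" where
  "weierstrass_zeta N w x = cliff_inverse x +
     (\<Sum>p. cliff_inverse (x - w (Suc p)) +
        (\<Sum>\<mu><N. (cliff_inverse (w (Suc p)) * x) ^ \<mu> * cliff_inverse (w (Suc p))))"

definition shift :: "'a::plus \<Rightarrow> ('a \<Rightarrow> 'b) \<Rightarrow> ('a \<Rightarrow> 'b)" where
  "shift a \<phi> = (\<lambda>x. \<phi> (x + a))"

definition id_minus_shift :: "'a::plus \<Rightarrow> ('a \<Rightarrow> 'b) \<Rightarrow> ('a \<Rightarrow> 'b::minus)" where
  "id_minus_shift a \<phi> = (\<lambda>x. \<phi> x - shift a \<phi> x)"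

primrec prod_id_minus_shift ::
  "nat \<Rightarrow> (nat \<Rightarrow> 'a::plus) \<Rightarrow> ('a \<Rightarrow> 'b) \<Rightarrow> ('a \<Rightarrow> 'b::minus)" where
  "prod_id_minus_shift 0 \<omega> = id"
| "prod_id_minus_shift (Suc N) \<omega> = prod_id_minus_shift N \<omega> \<circ> id_minus_shift (\<omega> (Suc N))"

end

theory Submission
  imports Defs
begin

text \<open>
  Write \<open>N = 2m + 2\<close>, \<open>L\<close> for the lattice of the \<open>2\<omega>\<^sub>j\<close>, \<open>q(x) = x\<^sup>-\<^sup>1\<close> and
  \<open>\<Delta>\<^sub>j = I - E\<^sub>j\<close>. The terms of \<open>\<zeta>\<close> are translates \<open>q(x - v)\<close>, \<open>v \<in> L\<close>, corrected by polynomials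
  of degree less than \<open>N\<close> in \<open>x\<close> that force absolute convergence. A product \<open>D\<close> of any \<open>N\<close>
  difference operators annihilates these corrections (\<open>differences_zeta_term\<close>), so that
  \<open>D \<zeta>(x) = \<Sum>v\<in>L. (D q)(x - v)\<close>, an absolutely convergent sum that is invariant under translations
  by \<open>L\<close> (\<open>differences_zeta_periodic\<close>). Absolute convergence holds because the geometric series gives
  corrected terms of size \<open>O(|v|\<^sup>-\<^sup>N\<^sup>-\<^sup>1)\<close> (\<open>zeta_term_bound\<close>), which is summable over a lattice of
  rank \<open>N\<close> (\<open>lattice_summable\<close>).

  The product \<open>D\<close> may repeat factors, and this freedom gives the other periods. Let
  \<open>C = \<Delta>\<^sub>1 \<cdots> \<Delta>\<^sub>N \<zeta>\<close> and let \<open>G\<close> be the product of the \<open>\<Delta>\<^sub>l\<close>, \<open>l \<noteq> i\<close>, applied to \<open>\<zeta>\<close>. Then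
  \<open>(I + E\<^sub>i) C = (I - E\<^sub>i\<^sup>2) G\<close>, while \<open>\<Delta>\<^sub>k G\<close> is the result of \<open>N\<close> differences and thus invariant
  under \<open>E\<^sub>i\<^sup>2\<close>. Therefore \<open>(I - E\<^sub>k) (I + E\<^sub>i) C = 0\<close>. Adding the same identity with \<open>i\<close> and \<open>k\<close>
  exchanged leaves \<open>2 (I - E\<^sub>i E\<^sub>k) C = 0\<close>, which is the assertion.
\<close>

section \<open>Iterated differences\<close>

primrec differences :: "'a::plus list \<Rightarrow> ('a \<Rightarrow> 'b) \<Rightarrow> ('a \<Rightarrow> 'b::minus)" where
  "differences [] f = f"
| "differences (a # as) f = differences as (id_minus_shift a f)"

lemma prod_id_minus_shift_conv_differences:
  "prod_id_minus_shift N \<omega> f = differences (map \<omega> (rev [1..<Suc N])) f"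
  by (induction N arbitrary: f) simp_all

lemma id_minus_shift_commute:
  fixes f :: "'a::ab_semigroup_add \<Rightarrow> 'b::ab_group_add"
  shows "id_minus_shift a (id_minus_shift b f) = id_minus_shift b (id_minus_shift a f)"
  by (simp add: id_minus_shift_def shift_def fun_eq_iff algebra_simps)

lemma differences_id_minus_shift:
  fixes f :: "'a::ab_semigroup_add \<Rightarrow> 'b::ab_group_add"
  shows "differences as (id_minus_shift a f) = id_minus_shift a (differences as f)"
proof (induction as arbitrary: f)
  case (Cons b as)
  then show ?case by (simp add: id_minus_shift_commute[of b a])
qed simp

text \<open>As difference operators commute, any one of them may be taken as the first.\<close>

lemma differences_remove1:
  fixes f :: "'a::ab_semigroup_add \<Rightarrow> 'b::ab_group_add"
  assumes "a \<in> set as"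
  shows "differences as f = differences (a # remove1 a as) f"
  using assms
  by (induction as arbitrary: f) (auto simp: id_minus_shift_commute[of a])

lemma differences_add:
  fixes f :: "'a::ab_semigroup_add \<Rightarrow> 'b::ab_group_add"
  shows "differences as (\<lambda>x. f x + g x) = (\<lambda>x. differences as f x + differences as g x)"
proof (induction as arbitrary: f g)
  case (Cons a as)
  have "id_minus_shift a (\<lambda>x. f x + g x) = (\<lambda>x. id_minus_shift a f x + id_minus_shift a g x)"
    by (simp add: id_minus_shift_def shift_def fun_eq_iff)
  then show ?case by (simp add: Cons.IH)
qed simp

lemma differences_translate:
  fixes f :: "'a::ab_group_add \<Rightarrow> 'b::ab_group_add"
  shows "differences as (\<lambda>x. f (x - v)) x = differences as f (x - v)"
proof (induction as arbitrary: f)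
  case (Cons a as)
  have "id_minus_shift a (\<lambda>x. f (x - v)) = (\<lambda>x. id_minus_shift a f (x - v))"
    by (simp add: id_minus_shift_def shift_def fun_eq_iff algebra_simps)
  then show ?case by (simp add: Cons.IH)
qed simp

lemma differences_has_sum:
  fixes f :: "'i \<Rightarrow> 'a::plus \<Rightarrow> 'b::topological_ab_group_add"
  assumes "\<And>x. x \<in> X \<Longrightarrow> ((\<lambda>i. f i x) has_sum F x) I"
    and "\<And>x a. x \<in> X \<Longrightarrow> a \<in> set as \<Longrightarrow> x + a \<in> X"
    and "x \<in> X"
  shows "((\<lambda>i. differences as (f i) x) has_sum differences as F x) I"
  using assms
proof (induction as arbitrary: f F)
  case (Cons a as)
  have "((\<lambda>i. id_minus_shift a (f i) y) has_sum id_minus_shift a F y) I" if "y \<in> X" for y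
  proof -
    have "((\<lambda>i. f i y + - f i (y + a)) has_sum (F y + - F (y + a))) I"
      using Cons.prems that by (intro has_sum_add) (auto simp: has_sum_uminus)
    then show ?thesis by (simp add: id_minus_shift_def shift_def)
  qed
  then show ?case using Cons by simp
qed simp

text \<open>A substitute for ``polynomial of degree less than \<open>n\<close>'' that needs no notion of polynomial in
  several noncommuting coordinates: all \<open>n\<close>-fold differences vanish.\<close>

primrec poly_below :: "nat \<Rightarrow> ('a::plus \<Rightarrow> 'b::ab_group_add) \<Rightarrow> bool" where
  "poly_below 0 = (\<lambda>f. f = (\<lambda>x. 0))"
| "poly_below (Suc n) = (\<lambda>f. \<forall>a. poly_below n (id_minus_shift a f))"

lemma poly_below_zero: "poly_below n (\<lambda>x. 0)"
  by (induction n) (simp_all add: id_minus_shift_def shift_def)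

lemma poly_below_Suc: "poly_below n f \<Longrightarrow> poly_below (Suc n) f"
proof (induction n arbitrary: f)
  case 0
  then show ?case by (simp add: id_minus_shift_def shift_def)
next
  case (Suc n)
  then show ?case by (metis poly_below.simps(2))
qed

lemma poly_below_mono: "poly_below n f \<Longrightarrow> n \<le> k \<Longrightarrow> poly_below k f"
  by (induction k) (auto simp del: poly_below.simps simp: le_Suc_eq intro: poly_below_Suc)

lemma poly_below_const: "poly_below (Suc 0) (\<lambda>x. d)"
  by (simp add: id_minus_shift_def shift_def)

lemma poly_below_add:
  assumes "poly_below n f" "poly_below n g"
  shows "poly_below n (\<lambda>x. f x + g x)"
  using assms
proof (induction n arbitrary: f g)
  case (Suc n)
  have "id_minus_shift a (\<lambda>x. f x + g x) = (\<lambda>x. id_minus_shift a f x + id_minus_shift a g x)"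
    for a by (simp add: id_minus_shift_def shift_def fun_eq_iff)
  then show ?case using Suc by simp
qed simp

lemma poly_below_sum:
  assumes "\<And>i. i \<in> I \<Longrightarrow> poly_below n (f i)"
  shows "poly_below n (\<lambda>x. \<Sum>i\<in>I. f i x)"
  using assms
  by (induction I rule: infinite_finite_induct) (simp_all add: poly_below_zero poly_below_add)

lemma poly_below_shift:
  fixes f :: "'a::ab_semigroup_add \<Rightarrow> 'b::ab_group_add"
  shows "poly_below n f \<Longrightarrow> poly_below n (\<lambda>x. f (x + b))"
proof (induction n arbitrary: f)
  case (Suc n)
  have "id_minus_shift a (\<lambda>x. f (x + b)) = (\<lambda>x. id_minus_shift a f (x + b))" for a
    by (simp add: id_minus_shift_def shift_def fun_eq_iff ac_simps)
  then show ?case using Suc by simp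
qed simp

lemma poly_below_mult_const:
  fixes f :: "'a::plus \<Rightarrow> 'b::ring"
  shows "poly_below n f \<Longrightarrow> poly_below n (\<lambda>x. c * f x)"
proof (induction n arbitrary: f)
  case (Suc n)
  have "id_minus_shift a (\<lambda>x. c * f x) = (\<lambda>x. c * id_minus_shift a f x)" for a
    by (simp add: id_minus_shift_def shift_def fun_eq_iff algebra_simps)
  then show ?case using Suc by simp
qed simp

text \<open>The degree grows by one because of the Leibniz rule
  \<open>\<Delta>\<^sub>a (l f) = l \<Delta>\<^sub>a f - l(a) E\<^sub>a f\<close>, in which \<open>l(a)\<close> is a constant.\<close>

lemma poly_below_mult_additive:
  fixes f :: "'a::ab_semigroup_add \<Rightarrow> 'b::ring"
  assumes l: "\<And>x y. l (x + y) = l x + l y"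
  shows "poly_below n f \<Longrightarrow> poly_below (Suc n) (\<lambda>x. l x * f x)"
proof (induction n arbitrary: f)
  case 0
  then show ?case by (simp add: id_minus_shift_def shift_def)
next
  case (Suc n)
  show ?case unfolding poly_below.simps(2)[of "Suc n"]
  proof
    fix a
    have eq: "id_minus_shift a (\<lambda>x. l x * f x)
        = (\<lambda>x. l x * id_minus_shift a f x + (- l a) * f (x + a))"
      by (simp add: id_minus_shift_def shift_def fun_eq_iff l algebra_simps)
    have "poly_below n (id_minus_shift a f)" using Suc.prems by simp
    then show "poly_below (Suc n) (id_minus_shift a (\<lambda>x. l x * f x))"
      unfolding eq
      by (intro poly_below_add poly_below_mult_const poly_below_shift Suc.IH Suc.prems)
  qed
qed

lemma poly_below_power:
  fixes c d :: "'a::ring_1"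
  shows "poly_below (Suc n) (\<lambda>x. (c * x) ^ n * d)"
proof (induction n)
  case 0
  show ?case using poly_below_const by simp
next
  case (Suc n)
  then show ?case
    using poly_below_mult_additive[of "\<lambda>x. c * x" "Suc n"] by (simp add: algebra_simps)
qed

lemma differences_poly_below:
  "poly_below (length as) f \<Longrightarrow> differences as f = (\<lambda>x. 0)"
  by (induction as arbitrary: f) simp_all


section \<open>Lattice sums\<close>

text \<open>The coordinate functionals extend to linear, hence bounded, functionals of the whole space.\<close>

lemma lattice_coordinate_bound:
  fixes \<omega> :: "nat \<Rightarrow> 'a::euclidean_space"
  assumes "inj_on \<omega> {1..N}" "independent (\<omega> ` {1..N})"
  obtains K where "K > 0"
    "\<And>c i. i \<in> {1..N} \<Longrightarrow> \<bar>c i\<bar> \<le> K * norm (\<Sum>j=1..N. c j *\<^sub>R \<omega> j)"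
proof -
  have "\<exists>B>0. \<forall>c. \<bar>c i\<bar> \<le> B * norm (\<Sum>j=1..N. c j *\<^sub>R \<omega> j)" if i: "i \<in> {1..N}" for i
  proof -
    obtain g :: "'a \<Rightarrow> real" where g: "linear g"
      "\<forall>b \<in> \<omega> ` {1..N}. g b = (if b = \<omega> i then 1 else 0)"
      using linear_independent_extend[OF assms(2), of "\<lambda>b. if b = \<omega> i then 1 else 0"] by blast
    obtain B where B: "B > 0" "\<And>x. norm (g x) \<le> B * norm x"
      using linear_bounded_pos[OF g(1)] by blast
    have "g (\<Sum>j=1..N. c j *\<^sub>R \<omega> j) = c i" for c
    proof -
      have "g (\<Sum>j=1..N. c j *\<^sub>R \<omega> j) = (\<Sum>j=1..N. c j * g (\<omega> j))"
        using g(1) by (simp add: linear_sum linear_scale)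
      also have "\<dots> = (\<Sum>j=1..N. if j = i then c j else 0)"
        using g(2) i inj_onD[OF assms(1)] by (intro sum.cong) auto
      finally show ?thesis using i by simp
    qed
    then have "\<bar>c i\<bar> \<le> B * norm (\<Sum>j=1..N. c j *\<^sub>R \<omega> j)" for c
      using B(2)[of "\<Sum>j=1..N. c j *\<^sub>R \<omega> j"] by simp
    then show ?thesis using B(1) by blast
  qed
  then have "\<forall>i\<in>{1..N}. \<exists>B>0. \<forall>c. \<bar>c i\<bar> \<le> B * norm (\<Sum>j=1..N. c j *\<^sub>R \<omega> j)" by blast
  then obtain B where B: "\<And>i. i \<in> {1..N} \<Longrightarrow> B i > 0"
    "\<And>i c. i \<in> {1..N} \<Longrightarrow> \<bar>c i\<bar> \<le> B i * norm (\<Sum>j=1..N. c j *\<^sub>R \<omega> j)"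
    by metis
  show ?thesis
  proof
    show "1 + (\<Sum>i=1..N. B i) > 0"
      using B(1) by (intro add_pos_nonneg sum_nonneg) (auto simp: less_imp_le)
    show "\<bar>c i\<bar> \<le> (1 + (\<Sum>i=1..N. B i)) * norm (\<Sum>j=1..N. c j *\<^sub>R \<omega> j)"
      if i: "i \<in> {1..N}" for c i
    proof -
      have "B i \<le> (\<Sum>i=1..N. B i)"
        using i B(1) by (intro member_le_sum) (auto simp: less_imp_le)
      then show ?thesis using B(2)[OF i, of c]
        by (smt (verit) mult_right_mono norm_ge_zero)
    qed
  qed
qed

lemma int_powr_sums_bounded:
  fixes s :: real
  assumes "s > 1"
  obtains M where "\<And>F :: int set. finite F \<Longrightarrow> (\<Sum>n\<in>F. (1 + \<bar>real_of_int n\<bar>) powr (-s)) \<le> M"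
proof -
  define h where "h n = (1 + real n) powr (-s)" for n
  have "summable (\<lambda>n. real n powr (-s))"
    using assms by (simp add: summable_real_powr_iff)
  then have h: "summable h"
    unfolding h_def by (subst (asm) summable_Suc_iff[symmetric]) (simp add: add.commute)
  have part: "(\<Sum>n\<in>F. h (nat \<bar>n\<bar>)) \<le> suminf h" if "finite F" "inj_on (\<lambda>n. nat \<bar>n\<bar>) F"
    for F :: "int set"
  proof -
    have "(\<Sum>n\<in>F. h (nat \<bar>n\<bar>)) = sum h ((\<lambda>n. nat \<bar>n\<bar>) ` F)"
      using that by (simp add: sum.reindex)
    also have "\<dots> \<le> suminf h"
      using that h by (intro sum_le_suminf) (auto simp: h_def)
    finally show ?thesis .
  qed
  show ?thesis
  proof
    fix F :: "int set" assume F: "finite F"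
    have "(\<Sum>n\<in>F. h (nat \<bar>n\<bar>)) = (\<Sum>n\<in>(F \<inter> {0..}) \<union> (F \<inter> {..<0}). h (nat \<bar>n\<bar>))"
      by (rule sum.cong) auto
    also have "\<dots>
        = (\<Sum>n\<in>F \<inter> {0..}. h (nat \<bar>n\<bar>)) + (\<Sum>n\<in>F \<inter> {..<0}. h (nat \<bar>n\<bar>))"
      using F by (intro sum.union_disjoint) auto
    also have "\<dots> \<le> suminf h + suminf h"
      using F by (intro add_mono part) (auto simp: inj_on_def)
    finally show "(\<Sum>n\<in>F. (1 + \<bar>real_of_int n\<bar>) powr (-s)) \<le> suminf h + suminf h"
      by (simp add: h_def)
  qed
qed

text \<open>No lattice points are counted: since every coordinate of \<open>v\<close> is \<open>O(|v|)\<close>, the power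
  \<open>|v|\<^sup>-\<^sup>N\<^sup>-\<^sup>1\<close> is at most a constant times \<open>\<Prod>j. (1 + |k\<^sub>j|)\<^sup>-\<^sup>s\<close> with \<open>s = 1 + 1/N\<close>. Over a box of
  coordinate vectors this majorant sums to a product of \<open>N\<close> partial sums of a convergent series
  over \<open>\<int>\<close>. At \<open>v = 0\<close> the term is \<open>1 / 0 = 0\<close>.\<close>

lemma lattice_summable:
  fixes \<omega> :: "nat \<Rightarrow> 'a::euclidean_space"
  assumes K: "K > 0"
      "\<And>c i. i \<in> {1..N} \<Longrightarrow> \<bar>c i\<bar> \<le> K * norm (\<Sum>j=1..N. c j *\<^sub>R \<omega> j)"
    and N: "N \<ge> 1"
  shows "(\<lambda>v. 1 / norm v ^ Suc N) summable_on int_span N \<omega>"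
proof -
  define s where "s = 1 + 1 / real N"
  define g where "g n = (1 + \<bar>real_of_int n\<bar>) powr (-s)" for n
  define P where "P k = (\<Sum>j=1..N. of_int (k j) *\<^sub>R \<omega> j)" for k :: "nat \<Rightarrow> int"
  have "s > 1" using N by (simp add: s_def)
  obtain M where M: "\<And>F. finite F \<Longrightarrow> sum g F \<le> M"
    unfolding g_def using int_powr_sums_bounded[OF \<open>s > 1\<close>] by blast
  have g0: "g n > 0" for n by (simp add: g_def)
  have span: "int_span N \<omega> \<subseteq> P ` PiE {1..N} (\<lambda>_. UNIV)"
  proof
    fix v assume "v \<in> int_span N \<omega>"
    then obtain k where "v = P k" by (auto simp: int_span_def P_def)
    then have "v = P (restrict k {1..N})" by (simp add: P_def)
    then show "v \<in> P ` PiE {1..N} (\<lambda>_. UNIV)" by auto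
  qed
  have term_le: "1 / norm (P k) ^ Suc N \<le> (2 * K) ^ Suc N * (\<Prod>j=1..N. g (k j))" for k
  proof (cases "P k = 0")
    case True
    then show ?thesis using K g0 by (simp add: prod_nonneg less_imp_le)
  next
    case False
    define r where "r = norm (P k)"
    have r: "r > 0" using False by (simp add: r_def)
    have coord: "\<bar>real_of_int (k i)\<bar> \<le> K * r" if "i \<in> {1..N}" for i
      using K(2)[OF that, of "\<lambda>j. of_int (k j)"] by (simp add: P_def r_def)
    obtain i where i: "i \<in> {1..N}" "k i \<noteq> 0"
      using False unfolding P_def by (metis (no_types, lifting) of_int_0 scaleR_zero_left sum.neutral)
    \<comment> \<open>A nonzero integer coordinate keeps \<open>K * r\<close> above \<open>1\<close>, so that \<open>1 + |k\<^sub>j|\<close> is also \<open>O(r)\<close>.\<close>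
    have "1 \<le> \<bar>real_of_int (k i)\<bar>" using i(2) by linarith
    then have "1 \<le> K * r" using coord[OF i(1)] by linarith
    then have c2: "1 + \<bar>real_of_int (k j)\<bar> \<le> 2 * K * r" if "j \<in> {1..N}" for j
      using coord[OF that] by linarith
    have pos: "2 * K * r > 0" using K r by simp
    have "(\<Prod>j=1..N. (2 * K * r) powr (-s)) \<le> (\<Prod>j=1..N. g (k j))"
    proof (rule prod_mono)
      fix j assume "j \<in> {1..N}"
      then show "0 \<le> (2 * K * r) powr (-s) \<and> (2 * K * r) powr (-s) \<le> g (k j)"
        using c2 \<open>s > 1\<close> by (auto simp: g_def intro!: powr_mono2')
    qed
    moreover have "(\<Prod>j=1..N. (2 * K * r) powr (-s)) = (2 * K * r) powr (- real (Suc N))"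
    proof -
      have "((2 * K * r) powr (-s)) ^ N = (2 * K * r) powr (-s * real N)"
        using pos by (subst powr_power) (auto simp: mult.commute)
      also have "-s * real N = - real (Suc N)" using N by (simp add: s_def field_simps)
      finally show ?thesis by simp
    qed
    moreover have "(2 * K * r) powr (- real (Suc N)) = 1 / (2 * K * r) ^ Suc N"
      using pos by (simp add: powr_minus_divide powr_realpow del: power_Suc of_nat_Suc)
    ultimately have "1 / (2 * K * r) ^ Suc N \<le> (\<Prod>j=1..N. g (k j))" by simp
    then have "(2 * K) ^ Suc N * (1 / (2 * K * r) ^ Suc N) \<le> (2 * K) ^ Suc N * (\<Prod>j=1..N. g (k j))"
      using K by (intro mult_left_mono) auto
    moreover have "(2 * K) ^ Suc N * (1 / (2 * K * r) ^ Suc N) = 1 / r ^ Suc N"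
      using K r by (simp add: power_mult_distrib[of "2 * K" r] del: power_Suc)
    ultimately show ?thesis by (simp add: r_def)
  qed
  have "(\<Sum>v\<in>F. 1 / norm v ^ Suc N) \<le> (2 * K) ^ Suc N * M ^ N"
    if F: "F \<subseteq> int_span N \<omega>" "finite F" for F
  proof -
    have "F \<subseteq> P ` PiE {1..N} (\<lambda>_. UNIV)" using F(1) span by (rule subset_trans)
    then obtain U where U: "U \<subseteq> PiE {1..N} (\<lambda>_. UNIV)" "inj_on P U" "F = P ` U"
      unfolding subset_image_inj by blast
    have "finite U" using F(2) U by (simp add: finite_image_iff)
    \<comment> \<open>The smallest box of coordinate vectors that contains \<open>U\<close>.\<close>
    define I where "I j = (\<lambda>k. k j) ` U" for j
    have I: "finite (I j)" for j using \<open>finite U\<close> by (simp add: I_def)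
    have UI: "U \<subseteq> PiE {1..N} I" using U(1) by (fastforce simp: I_def PiE_def Pi_def extensional_def)
    have "(\<Sum>v\<in>F. 1 / norm v ^ Suc N) = (\<Sum>k\<in>U. 1 / norm (P k) ^ Suc N)"
      using U by (simp add: sum.reindex)
    also have "\<dots> \<le> (\<Sum>k\<in>U. (2 * K) ^ Suc N * (\<Prod>j=1..N. g (k j)))"
      by (intro sum_mono term_le)
    also have "\<dots> \<le> (\<Sum>k\<in>PiE {1..N} I. (2 * K) ^ Suc N * (\<Prod>j=1..N. g (k j)))"
      using UI I K g0 by (intro sum_mono2 finite_PiE)
        (auto intro!: mult_nonneg_nonneg prod_nonneg simp: less_imp_le simp del: power_Suc)
    also have "\<dots> = (2 * K) ^ Suc N * (\<Prod>j=1..N. \<Sum>n\<in>I j. g n)"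
      by (subst prod_sum_PiE) (use I in \<open>simp_all add: sum_distrib_left\<close>)
    also have "\<dots> \<le> (2 * K) ^ Suc N * (\<Prod>j=1..N. M)"
      using K g0 I M by (intro mult_left_mono prod_mono) (auto intro!: sum_nonneg simp: less_imp_le)
    finally show ?thesis by simp
  qed
  then show ?thesis
    by (intro nonneg_bdd_above_summable_on bdd_aboveI2[where M = "(2 * K) ^ Suc N * M ^ N"]) auto
qed

lemma finite_lattice_ball:
  fixes \<omega> :: "nat \<Rightarrow> 'a::euclidean_space"
  assumes K: "K > 0"
      "\<And>c i. i \<in> {1..N} \<Longrightarrow> \<bar>c i\<bar> \<le> K * norm (\<Sum>j=1..N. c j *\<^sub>R \<omega> j)"
  shows "finite {v \<in> int_span N \<omega>. norm v \<le> R}"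
proof -
  define P where "P k = (\<Sum>j=1..N. of_int (k j) *\<^sub>R \<omega> j)" for k :: "nat \<Rightarrow> int"
  define Z where "Z = \<lceil>K * R\<rceil>"
  have "{v \<in> int_span N \<omega>. norm v \<le> R} \<subseteq> P ` PiE {1..N} (\<lambda>_. {-Z..Z})"
  proof
    fix v assume v: "v \<in> {v \<in> int_span N \<omega>. norm v \<le> R}"
    then obtain k where k: "v = P k" by (auto simp: int_span_def P_def)
    have "k i \<in> {-Z..Z}" if "i \<in> {1..N}" for i
    proof -
      have "\<bar>real_of_int (k i)\<bar> \<le> K * norm v"
        using K(2)[OF that, of "\<lambda>j. of_int (k j)"] by (simp add: P_def k)
      also have "\<dots> \<le> K * R" using v K(1) by simp
      finally show ?thesis unfolding Z_def by (auto simp: abs_le_iff) linarith+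
    qed
    then have "restrict k {1..N} \<in> PiE {1..N} (\<lambda>_. {-Z..Z})" by auto
    moreover have "v = P (restrict k {1..N})" by (simp add: P_def k)
    ultimately show "v \<in> P ` PiE {1..N} (\<lambda>_. {-Z..Z})" by blast
  qed
  then show ?thesis by (rule finite_subset) (auto intro!: finite_imageI finite_PiE)
qed

lemma int_span_minus:
  assumes "u \<in> int_span N \<omega>" "v \<in> int_span N \<omega>"
  shows "u - v \<in> int_span N \<omega>"
proof -
  obtain k l where "u = (\<Sum>j=1..N. of_int (k j) *\<^sub>R \<omega> j)" "v = (\<Sum>j=1..N. of_int (l j) *\<^sub>R \<omega> j)"
    using assms by (auto simp: int_span_def)
  then have "u - v = (\<Sum>j=1..N. of_int (k j - l j) *\<^sub>R \<omega> j)"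
    by (simp add: sum_subtractf scaleR_diff_left)
  then show ?thesis
    unfolding int_span_def mem_Collect_eq by (intro exI[of _ "\<lambda>j. k j - l j"]) simp
qed

lemma int_span_zero: "0 \<in> int_span N \<omega>"
  unfolding int_span_def by (auto intro!: exI[of _ "\<lambda>_. 0"])

lemma int_span_add:
  assumes "u \<in> int_span N \<omega>" "v \<in> int_span N \<omega>"
  shows "u + v \<in> int_span N \<omega>"
  using int_span_minus[OF assms(1) int_span_minus[OF int_span_zero assms(2)]] by simp

lemma int_span_base:
  assumes "i \<in> {1..N}"
  shows "\<omega> i \<in> int_span N \<omega>"
proof -
  have "(\<Sum>j=1..N. of_int (if j = i then 1 else 0) *\<^sub>R \<omega> j) = (\<Sum>j=1..N. if j = i then \<omega> j else 0)"
    by (intro sum.cong) auto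
  also have "\<dots> = \<omega> i" using assms by simp
  finally show ?thesis
    unfolding int_span_def mem_Collect_eq by (intro exI[of _ "\<lambda>j. if j = i then 1 else 0"]) simp
qed


section \<open>Estimates in the Clifford algebra\<close>

lemma subspace_paravectors: "subspace (paravectors :: 'n::{finite,linorder} clifford set)"
proof -
  show ?thesis
    unfolding subspace_def
  proof (intro conjI ballI allI)
    show "(0 :: 'n clifford) \<in> paravectors"
      unfolding paravectors_def mem_Collect_eq by (rule exI[of _ 0], rule exI[of _ "\<lambda>_. 0"]) simp
  next
    fix x y :: "'n clifford" assume "x \<in> paravectors" "y \<in> paravectors"
    then obtain a v b u where "x = of_real a + (\<Sum>i\<in>UNIV. v i *\<^sub>R gen i)"
      "y = of_real b + (\<Sum>i\<in>UNIV. u i *\<^sub>R gen i)" by (auto simp: paravectors_def)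
    then have "x + y = of_real (a + b) + (\<Sum>i\<in>UNIV. (v i + u i) *\<^sub>R gen i)"
      by (simp add: scaleR_add_left sum.distrib)
    then show "x + y \<in> paravectors" unfolding paravectors_def mem_Collect_eq
      by (intro exI[of _ "a + b"] exI[of _ "\<lambda>i. v i + u i"]) simp
  next
    fix c and x :: "'n clifford" assume "x \<in> paravectors"
    then obtain a v where "x = of_real a + (\<Sum>i\<in>UNIV. v i *\<^sub>R gen i)"
      by (auto simp: paravectors_def)
    then have "c *\<^sub>R x = of_real (c * a) + (\<Sum>i\<in>UNIV. (c * v i) *\<^sub>R gen i)"
      by (simp add: scaleR_add_right scaleR_sum_right of_real_def)
    then show "c *\<^sub>R x \<in> paravectors" unfolding paravectors_def mem_Collect_eq
      by (intro exI[of _ "c * a"] exI[of _ "\<lambda>i. c * v i"]) simp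
  qed
qed

lemma coord_of_real: "coord (of_real a) A = (if A = {} then a else 0)"
  by (simp add: of_real_def one_clifford_def)

lemma norm_paravector:
  "(norm (of_real a + (\<Sum>i\<in>UNIV. v i *\<^sub>R gen i) :: 'n::{finite,linorder} clifford))\<^sup>2
     = a\<^sup>2 + (\<Sum>i\<in>UNIV. (v i)\<^sup>2)"
proof -
  define x :: "'n clifford" where "x = of_real a + (\<Sum>i\<in>UNIV. v i *\<^sub>R gen i)"
  have x0: "coord x {} = a" by (simp add: x_def coord_of_real blade_def)
  have x1: "coord x {i} = v i" for i
  proof -
    have "coord x {i} = (\<Sum>j\<in>UNIV. v j * (if i = j then 1 else 0))"
      unfolding x_def by (simp add: coord_of_real blade_def)
    also have "\<dots> = (\<Sum>j\<in>UNIV. if j = i then v j else 0)"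
      by (rule sum.cong) auto
    finally show ?thesis by simp
  qed
  have x2: "coord x A = 0" if "A \<notin> insert {} (range (\<lambda>i. {i}))" for A
    using that by (auto simp: x_def coord_of_real blade_def intro!: sum.neutral split: if_splits)
  have "(norm x)\<^sup>2 = (\<Sum>A\<in>UNIV. (coord x A)\<^sup>2)"
    unfolding power2_norm_eq_inner inner_clifford_def by (simp add: power2_eq_square)
  also have "\<dots> = (\<Sum>A\<in>insert {} (range (\<lambda>i. {i})). (coord x A)\<^sup>2)"
    by (rule sum.mono_neutral_right) (use x2 in auto)
  also have "\<dots> = a\<^sup>2 + (\<Sum>A\<in>range (\<lambda>i. {i}). (coord x A)\<^sup>2)"
    by (subst sum.insert) (auto simp: x0)
  also have "(\<Sum>A\<in>range (\<lambda>i. {i}). (coord x A)\<^sup>2) = (\<Sum>i\<in>UNIV. (v i)\<^sup>2)"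
    by (subst sum.reindex) (auto simp: x1)
  finally show ?thesis by (simp add: x_def)
qed

text \<open>The inverse of \<open>a + V\<close> is the conjugate \<open>a - V\<close>, which has the same norm, divided by the square
  of that norm.\<close>

lemma norm_cliff_inverse:
  fixes x :: "'n::{finite,linorder} clifford"
  assumes "x \<in> paravectors" "x \<noteq> 0"
  shows "norm (cliff_inverse x) = 1 / norm x"
proof -
  obtain a v where x: "x = of_real a + (\<Sum>i\<in>UNIV. v i *\<^sub>R gen i)"
    using assms(1) by (auto simp: paravectors_def)
  define V :: "'n clifford" where "V = (\<Sum>i\<in>UNIV. v i *\<^sub>R gen i)"
  define q where "q = a\<^sup>2 + (\<Sum>i\<in>UNIV. (v i)\<^sup>2)"
  define z :: "'n clifford" where "z = of_real a - V"
  have xV: "x = of_real a + V" by (simp add: x V_def)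
  have nx: "(norm x)\<^sup>2 = q" unfolding x q_def by (rule norm_paravector)
  have "z = of_real a + (\<Sum>i\<in>UNIV. (- v i) *\<^sub>R gen i)"
    by (simp add: z_def V_def sum_negf)
  then have "(norm z)\<^sup>2 = q" using norm_paravector[of a "\<lambda>i. - v i"] by (simp add: q_def)
  then have nz: "norm z = norm x" using nx by (metis norm_ge_zero power2_eq_imp_eq)
  have "q \<noteq> 0" using nx assms(2) by auto
  have VV: "V * V = of_real (- (\<Sum>i\<in>UNIV. (v i)\<^sup>2))"
    unfolding V_def by (rule vector_square)
  have aV: "of_real a * V = V * of_real a"
    by (simp add: of_real_def)
  have "x * z = of_real q" "z * x = of_real q"
    unfolding xV z_def using aV VV by (simp_all add: algebra_simps q_def power2_eq_square)
  then have "cliff_inverse x = (1 / q) *\<^sub>R z"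
    using \<open>q \<noteq> 0\<close> by (intro cliff_inverse_eqI) (simp_all add: of_real_def)
  then have "norm (cliff_inverse x) = norm x / (norm x)\<^sup>2"
    using nz by (simp add: nx q_def sum_nonneg)
  then show ?thesis by (simp add: power2_eq_square)
qed

text \<open>The Euclidean norm on blades is in general not submultiplicative; a constant factor repairs this in finite
  dimension and does not affect convergence.\<close>

lemma clifford_mult_bound:
  obtains K where "K > 0"
    "\<And>x y :: 'n::{finite,linorder} clifford. norm (x * y) \<le> K * norm x * norm y"
proof -
  have "bilinear ((*) :: 'n clifford \<Rightarrow> _)"
    by (auto simp: bilinear_def algebra_simps intro!: linearI)
  then have "bounded_bilinear ((*) :: 'n clifford \<Rightarrow> _)"
    by (simp add: bilinear_conv_bounded_bilinear)
  from bounded_bilinear.pos_bounded[OF this] show ?thesis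
    using that by (metis mult.assoc mult.commute)
qed

definition zeta_term :: "nat \<Rightarrow> 'n::{finite,linorder} clifford \<Rightarrow> 'n clifford \<Rightarrow> 'n clifford" where
  "zeta_term N v x = cliff_inverse (x - v) +
     (\<Sum>\<mu><N. (cliff_inverse v * x) ^ \<mu> * cliff_inverse v)"

text \<open>With \<open>u = v\<^sup>-\<^sup>1 x\<close> one has \<open>x - v = v (u - 1)\<close>, so the correction is the partial sum of the geometric
  series for \<open>-(x - v)\<^sup>-\<^sup>1\<close>, and what is left is its remainder.\<close>

lemma zeta_term_eq:
  fixes x v :: "'n::{finite,linorder} clifford"
  assumes "x \<in> paravectors" "v \<in> paravectors" "v \<noteq> 0" "x \<noteq> v"
  shows "zeta_term N v x
    = cliff_inverse (x - v) * (v * ((cliff_inverse v * x) ^ N * cliff_inverse v))"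
proof -
  define u where "u = cliff_inverse v * x"
  have v: "v * cliff_inverse v = 1" "cliff_inverse v * v = 1"
    using paravector_inverse assms by blast+
  have "x - v \<in> paravectors" using assms subspace_diff[OF subspace_paravectors] by blast
  then have xv: "cliff_inverse (x - v) * (x - v) = 1"
    using paravector_inverse(2)[of "x - v"] assms by simp
  have vu: "x - v = v * (u - 1)"
    by (simp add: u_def algebra_simps v(1) flip: mult.assoc)
  have "(u - 1) * (\<Sum>\<mu><N. u ^ \<mu>) = u ^ N - 1"
    by (induction N) (simp_all add: algebra_simps)
  then have "(x - v) * ((\<Sum>\<mu><N. u ^ \<mu>) * cliff_inverse v) = v * ((u ^ N - 1) * cliff_inverse v)"
    by (metis vu mult.assoc)
  also have "\<dots> = v * (u ^ N * cliff_inverse v) - 1"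
    by (simp add: algebra_simps v)
  finally have "(x - v) * (\<Sum>\<mu><N. u ^ \<mu> * cliff_inverse v) = v * (u ^ N * cliff_inverse v) - 1"
    by (simp add: sum_distrib_right)
  then have "cliff_inverse (x - v) * ((x - v) * (\<Sum>\<mu><N. u ^ \<mu> * cliff_inverse v))
      = cliff_inverse (x - v) * (v * (u ^ N * cliff_inverse v)) - cliff_inverse (x - v)"
    by (simp only: right_diff_distrib mult_1_right)
  then have "(\<Sum>\<mu><N. u ^ \<mu> * cliff_inverse v)
      = cliff_inverse (x - v) * (v * (u ^ N * cliff_inverse v)) - cliff_inverse (x - v)"
    by (simp add: xv flip: mult.assoc)
  then show ?thesis by (simp add: zeta_term_def u_def)
qed

lemma zeta_term_bound:
  fixes x :: "'n::{finite,linorder} clifford"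
  assumes "x \<in> paravectors"
  obtains B where "\<And>v. v \<in> paravectors \<Longrightarrow> v \<noteq> 0 \<Longrightarrow> 2 * norm x \<le> norm v \<Longrightarrow>
    norm (zeta_term N v x) \<le> B * (1 / norm v ^ Suc N)"
proof -
  obtain K where K: "K > 0" "\<And>x y :: 'n clifford. norm (x * y) \<le> K * norm x * norm y"
    using clifford_mult_bound by blast
  have pow: "norm (u ^ n * z) \<le> (K * norm u) ^ n * norm z" for u z :: "'n clifford" and n
  proof (induction n)
    case (Suc n)
    have "norm (u ^ Suc n * z) \<le> K * norm u * norm (u ^ n * z)"
      using K(2)[of u "u ^ n * z"] by (simp add: mult.assoc)
    also have "\<dots> \<le> K * norm u * ((K * norm u) ^ n * norm z)"
      using Suc K(1) by (intro mult_left_mono) auto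
    finally show ?case by (simp add: mult.assoc)
  qed simp
  show ?thesis
  proof
    fix v :: "'n clifford"
    assume v: "v \<in> paravectors" "v \<noteq> 0" "2 * norm x \<le> norm v"
    define r where "r = norm v"
    have r: "r > 0" using v by (simp add: r_def)
    have "x \<noteq> v" using v by auto
    have "x - v \<in> paravectors" using assms v subspace_diff[OF subspace_paravectors] by blast
    then have "norm (cliff_inverse (x - v)) = 1 / norm (x - v)"
      using \<open>x \<noteq> v\<close> by (intro norm_cliff_inverse) auto
    also have "\<dots> \<le> 1 / (r / 2)"
    proof -
      have "r - norm x \<le> norm (x - v)"
        unfolding r_def by (metis norm_minus_commute norm_triangle_ineq2)
      then show ?thesis using v(3) r by (intro frac_le) (auto simp: r_def)
    qed
    finally have i1: "norm (cliff_inverse (x - v)) \<le> 2 / r" by simp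
    have i2: "norm (cliff_inverse v) = 1 / r"
      using v norm_cliff_inverse by (simp add: r_def)
    have u: "norm (cliff_inverse v * x) \<le> K * norm x / r"
      using K(2)[of "cliff_inverse v" x] by (simp add: i2)
    let ?p = "(cliff_inverse v * x) ^ N * cliff_inverse v"
    have "norm ?p \<le> (K * norm (cliff_inverse v * x)) ^ N * (1 / r)"
      using pow[of "cliff_inverse v * x" N "cliff_inverse v"] by (simp add: i2)
    also have "\<dots> \<le> (K * (K * norm x / r)) ^ N * (1 / r)"
      using K(1) r u by (intro mult_right_mono power_mono mult_left_mono) auto
    also have "\<dots> = (K * K * norm x) ^ N / r ^ Suc N"
      by (simp add: power_divide mult.assoc)
    finally have p: "norm ?p \<le> (K * K * norm x) ^ N / r ^ Suc N" .
    have "norm (zeta_term N v x) = norm (cliff_inverse (x - v) * (v * ?p))"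
      using zeta_term_eq[OF assms v(1,2) \<open>x \<noteq> v\<close>] by simp
    also have "\<dots> \<le> K * norm (cliff_inverse (x - v)) * norm (v * ?p)" by (rule K(2))
    also have "\<dots> \<le> K * (2 / r) * (K * r * ((K * K * norm x) ^ N / r ^ Suc N))"
    proof (intro mult_mono)
      have "norm (v * ?p) \<le> K * r * norm ?p" using K(2)[of v ?p] by (simp add: r_def)
      also have "\<dots> \<le> K * r * ((K * K * norm x) ^ N / r ^ Suc N)"
        using p K(1) r by (intro mult_left_mono) auto
      finally show "norm (v * ?p) \<le> K * r * ((K * K * norm x) ^ N / r ^ Suc N)" .
    qed (use K(1) r i1 in auto)
    also have "\<dots> = 2 * K * K * (K * K * norm x) ^ N * (1 / r ^ Suc N)"
      using r by (simp add: field_simps)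
    finally show "norm (zeta_term N v x) \<le> 2 * K * K * (K * K * norm x) ^ N * (1 / norm v ^ Suc N)"
      by (simp add: r_def)
  qed
qed

text \<open>The bound on the terms is available outside a ball, which contains only finitely many lattice
  points. One of these may be \<open>x\<close>; there the term contains the value of \<open>cliff_inverse\<close> at \<open>0\<close>,
  which is immaterial for convergence.\<close>

lemma zeta_term_summable:
  fixes x :: "'n::{finite,linorder} clifford"
  assumes x: "x \<in> paravectors"
    and L: "int_span N \<omega> \<subseteq> paravectors"
    and K: "K > 0"
      "\<And>c i. i \<in> {1..N} \<Longrightarrow> \<bar>c i\<bar> \<le> K * norm (\<Sum>j=1..N. c j *\<^sub>R \<omega> j)"
    and N: "N \<ge> 1"
  shows "(\<lambda>v. zeta_term N v x) summable_on (int_span N \<omega> - {0})"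
proof -
  define S where "S = {v \<in> int_span N \<omega>. norm v \<le> 2 * norm x}"
  have "finite S" unfolding S_def by (rule finite_lattice_ball[OF K])
  obtain B where B: "\<And>v. v \<in> paravectors \<Longrightarrow> v \<noteq> 0 \<Longrightarrow> 2 * norm x \<le> norm v \<Longrightarrow>
    norm (zeta_term N v x) \<le> B * (1 / norm v ^ Suc N)"
    using zeta_term_bound[OF x] by blast
  have "(\<lambda>v. B * (1 / norm v ^ Suc N)) summable_on (int_span N \<omega> - {0} - S)"
    by (rule summable_on_subset[OF summable_on_cmult_right[OF lattice_summable[OF K N]]]) auto
  then have "(\<lambda>v. norm (zeta_term N v x)) summable_on (int_span N \<omega> - {0} - S)"
    by (rule Infinite_Sum.abs_summable_on_comparison_test') (use B L in \<open>auto simp: S_def\<close>)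
  then have "(\<lambda>v. zeta_term N v x) summable_on (int_span N \<omega> - {0} - S)"
    by (rule Infinite_Sum.abs_summable_summable)
  then have "(\<lambda>v. zeta_term N v x) summable_on ((int_span N \<omega> - {0} - S) \<union> (S - {0}))"
    using \<open>finite S\<close> by (intro summable_on_Un_disjoint) auto
  moreover have "(int_span N \<omega> - {0} - S) \<union> (S - {0}) = int_span N \<omega> - {0}"
    by (auto simp: S_def)
  ultimately show ?thesis by simp
qed


section \<open>Differences of the zeta function\<close>

text \<open>Unconditional convergence turns the series along the enumeration into a sum over the lattice,
  which can be reindexed by translations.\<close>

lemma weierstrass_zeta_has_sum:
  fixes x :: "'n::{finite,linorder} clifford"
  assumes enum: "lattice_enumeration w L"
    and sum: "(\<lambda>v. zeta_term N v x) summable_on (L - {0})"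
  shows "((\<lambda>v. if v = 0 then cliff_inverse x else zeta_term N v x)
    has_sum weierstrass_zeta N w x) L"
proof -
  have w: "inj w" "range w = L" "w 0 = 0"
    using enum by (auto simp: lattice_enumeration_def bij_betw_def)
  have bij: "bij_betw (\<lambda>p. w (Suc p)) UNIV (L - {0})"
  proof (rule bij_betwI')
    show "w (Suc p) = w (Suc q) \<longleftrightarrow> p = q" for p q using w(1) by (auto dest: injD)
    show "w (Suc p) \<in> L - {0}" for p using w by (metis Diff_iff injD nat.distinct(1) rangeI singletonD)
    show "\<exists>p\<in>UNIV. v = w (Suc p)" if "v \<in> L - {0}" for v
      using that w by (metis Diff_iff UNIV_I imageE not0_implies_Suc singletonI)
  qed
  obtain S where S: "((\<lambda>v. zeta_term N v x) has_sum S) (L - {0})"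
    using sum by (auto simp: summable_on_def)
  then have "((\<lambda>p. zeta_term N (w (Suc p)) x) has_sum S) UNIV"
    using has_sum_reindex_bij_betw[OF bij, of "\<lambda>v. zeta_term N v x" S] by simp
  then have "(\<Sum>p. zeta_term N (w (Suc p)) x) = S"
    by (metis has_sum_imp_sums sums_unique)
  then have "weierstrass_zeta N w x = cliff_inverse x + S"
    by (simp add: weierstrass_zeta_def zeta_term_def)
  moreover have "((\<lambda>v. if v = 0 then cliff_inverse x else zeta_term N v x) has_sum S) (L - {0})"
    using S by (rule has_sum_cong[THEN iffD1, rotated]) auto
  moreover have "insert 0 (L - {0}) = L" using w by auto
  ultimately show ?thesis
    using has_sum_insert[of 0 "L - {0}" "\<lambda>v. if v = 0 then cliff_inverse x else zeta_term N v x" S]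
    by simp
qed

lemma differences_zeta_term:
  fixes x :: "'n::{finite,linorder} clifford"
  assumes "length as = N"
  shows "differences as (\<lambda>x. if v = 0 then cliff_inverse x else zeta_term N v x) x
    = differences as cliff_inverse (x - v)"
proof (cases "v = 0")
  case False
  have "poly_below N (\<lambda>x. \<Sum>\<mu><N. (cliff_inverse v * x) ^ \<mu> * cliff_inverse v)"
    by (intro poly_below_sum poly_below_mono[OF poly_below_power]) auto
  then have "differences as (\<lambda>x. \<Sum>\<mu><N. (cliff_inverse v * x) ^ \<mu> * cliff_inverse v) = (\<lambda>x. 0)"
    using assms by (intro differences_poly_below) simp
  then show ?thesis
    using False by (simp add: zeta_term_def differences_add differences_translate)
qed simp

text \<open>The translation by \<open>u\<close> is absorbed by the index of summation, \<open>v \<mapsto> v + u\<close>. The list \<open>as\<close> is not tied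
  to the half periods, so that an operator may occur in it twice.\<close>

lemma differences_zeta_periodic:
  fixes \<omega> w :: "nat \<Rightarrow> 'n::{finite,linorder} clifford"
  assumes \<omega>: "\<And>j. j \<in> {1..N} \<Longrightarrow> \<omega> j \<in> paravectors"
    and indep: "inj_on \<omega> {1..N}" "independent (\<omega> ` {1..N})"
    and N: "N \<ge> 1"
    and enum: "lattice_enumeration w (int_span N (\<lambda>j. 2 *\<^sub>R \<omega> j))"
    and as: "length as = N" "set as \<subseteq> paravectors"
    and x: "x \<in> paravectors" and u: "u \<in> int_span N (\<lambda>j. 2 *\<^sub>R \<omega> j)"
  shows "differences as (weierstrass_zeta N w) (x + u) = differences as (weierstrass_zeta N w) x"
proof -
  define L where "L = int_span N (\<lambda>j. 2 *\<^sub>R \<omega> j)"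
  note sub = subspace_paravectors[where 'n = 'n]
  have L: "L \<subseteq> paravectors"
    unfolding L_def int_span_def
    by (auto intro!: subspace_sum[OF sub] subspace_scale[OF sub] \<omega>)
  obtain K where K: "K > 0"
    "\<And>c i. i \<in> {1..N} \<Longrightarrow> \<bar>c i\<bar> \<le> K * norm (\<Sum>j=1..N. c j *\<^sub>R \<omega> j)"
    using lattice_coordinate_bound[OF indep] by blast
  have K2: "\<bar>c i\<bar> \<le> K * norm (\<Sum>j=1..N. c j *\<^sub>R (2 *\<^sub>R \<omega> j))" if "i \<in> {1..N}" for c i
  proof -
    have "(\<Sum>j=1..N. c j *\<^sub>R (2 *\<^sub>R \<omega> j)) = 2 *\<^sub>R (\<Sum>j=1..N. c j *\<^sub>R \<omega> j)"
      by (simp add: scaleR_sum_right mult.commute)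
    then have "K * norm (\<Sum>j=1..N. c j *\<^sub>R \<omega> j) \<le> K * norm (\<Sum>j=1..N. c j *\<^sub>R (2 *\<^sub>R \<omega> j))"
      using K(1) by (intro mult_left_mono) auto
    then show ?thesis using K(2)[OF that, of c] by linarith
  qed
  have zeta: "((\<lambda>v. if v = 0 then cliff_inverse y else zeta_term N v y)
      has_sum weierstrass_zeta N w y) L" if "y \<in> paravectors" for y
    unfolding L_def
    by (rule weierstrass_zeta_has_sum[OF enum])
       (rule zeta_term_summable[OF that L[unfolded L_def] K(1) K2 N])
  have D: "((\<lambda>v. differences as cliff_inverse (y - v))
      has_sum differences as (weierstrass_zeta N w) y) L" if "y \<in> paravectors" for y
  proof -
    have "((\<lambda>v. differences as (\<lambda>x. if v = 0 then cliff_inverse x else zeta_term N v x) y)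
      has_sum differences as (weierstrass_zeta N w) y) L"
      using zeta as(2) subspace_add[OF sub] that
      by (intro differences_has_sum[where X = paravectors]) auto
    then show ?thesis by (simp only: differences_zeta_term[OF as(1)])
  qed
  have "bij_betw (\<lambda>v. v + u) L L"
    by (rule bij_betwI[where g = "\<lambda>v. v - u"])
       (use u in \<open>auto simp: L_def int_span_add int_span_minus\<close>)
  moreover have xu: "x + u \<in> paravectors" using x u L subspace_add[OF sub] by (auto simp: L_def)
  ultimately have "((\<lambda>v. differences as cliff_inverse (x + u - (v + u)))
      has_sum differences as (weierstrass_zeta N w) (x + u)) L"
    using D[OF xu] has_sum_reindex_bij_betw[of "\<lambda>v. v + u" L L
      "\<lambda>v. differences as cliff_inverse (x + u - v)"] by blast
  then have "((\<lambda>v. differences as cliff_inverse (x - v))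
      has_sum differences as (weierstrass_zeta N w) (x + u)) L" by simp
  then show ?thesis using D[OF x] by (rule has_sum_unique)
qed


section \<open>The periods\<close>

lemma prod_id_minus_shift_zeta_periods:
  fixes N :: nat and \<omega> w :: "nat \<Rightarrow> 'n::{finite,linorder} clifford"
  defines "C \<equiv> prod_id_minus_shift N \<omega> (weierstrass_zeta N w)"
  assumes \<omega>: "\<And>j. j \<in> {1..N} \<Longrightarrow> \<omega> j \<in> paravectors"
    and indep: "inj_on \<omega> {1..N}" "independent (\<omega> ` {1..N})"
    and enum: "lattice_enumeration w (int_span N (\<lambda>j. 2 *\<^sub>R \<omega> j))"
    and i: "i \<in> {1..N}" and k: "k \<in> {1..N}"
    and x: "x \<in> paravectors"
  shows "C (x + \<omega> i + \<omega> k) = C x"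
proof -
  define as where "as = map \<omega> (rev [1..<Suc N])"
  have set_as: "set as = \<omega> ` {1..N}"
    by (simp add: as_def atLeastLessThanSuc_atLeastAtMost del: upt_Suc)
  have length_as: "length as = N"
    by (simp add: as_def del: upt_Suc)
  \<comment> \<open>This is \<open>(I - E\<^sub>b) (I + E\<^sub>a) C = 0\<close>: one factor \<open>I - E\<^sub>a\<close> of the product is traded for \<open>I - E\<^sub>b\<close>.\<close>
  have relation: "C x + C (x + \<omega> a) = C (x + \<omega> b) + C (x + \<omega> a + \<omega> b)"
    if a: "a \<in> {1..N}" and b: "b \<in> {1..N}" for a b
  proof -
    define bs where "bs = remove1 (\<omega> a) as"
    define G where "G = differences bs (weierstrass_zeta N w)"
    have mem: "\<omega> a \<in> set as" using a set_as by blast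
    have "C = differences (\<omega> a # bs) (weierstrass_zeta N w)"
      unfolding C_def bs_def prod_id_minus_shift_conv_differences as_def[symmetric]
      by (rule differences_remove1[OF mem])
    also have "\<dots> = id_minus_shift (\<omega> a) G"
      by (simp add: G_def differences_id_minus_shift)
    finally have C: "C y = G y - G (y + \<omega> a)" for y
      by (simp add: id_minus_shift_def shift_def)
    have len: "length (\<omega> b # bs) = N"
      using mem a by (simp add: bs_def length_remove1 length_as)
    have "set bs \<subseteq> set as" unfolding bs_def by (rule set_remove1_subset)
    then have set: "set (\<omega> b # bs) \<subseteq> paravectors" using \<omega> b set_as by auto
    have "differences (\<omega> b # bs) (weierstrass_zeta N w) (x + 2 *\<^sub>R \<omega> a)
        = differences (\<omega> b # bs) (weierstrass_zeta N w) x"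
    proof (rule differences_zeta_periodic[OF \<omega> indep _ enum len set x])
      show "1 \<le> N" using a by simp
      show "2 *\<^sub>R \<omega> a \<in> int_span N (\<lambda>j. 2 *\<^sub>R \<omega> j)"
        using a by (rule int_span_base)
    qed
    then have "id_minus_shift (\<omega> b) G (x + 2 *\<^sub>R \<omega> a) = id_minus_shift (\<omega> b) G x"
      by (simp add: G_def differences_id_minus_shift)
    then have "G x = G (x + 2 *\<^sub>R \<omega> a) - G (x + 2 *\<^sub>R \<omega> a + \<omega> b) + G (x + \<omega> b)"
      by (simp add: id_minus_shift_def shift_def)
    moreover have "C (x + \<omega> a) = G (x + \<omega> a) - G (x + 2 *\<^sub>R \<omega> a)"
      "C (x + \<omega> b) = G (x + \<omega> b) - G (x + \<omega> a + \<omega> b)"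
      "C (x + \<omega> a + \<omega> b) = G (x + \<omega> a + \<omega> b) - G (x + 2 *\<^sub>R \<omega> a + \<omega> b)"
      by (simp_all add: C scaleR_2 ac_simps)
    ultimately show ?thesis by (simp add: C[of x])
  qed
  have swap: "x + \<omega> k + \<omega> i = x + \<omega> i + \<omega> k" by (simp add: ac_simps)
  define p q y z where "p = C (x + \<omega> i)" and "q = C (x + \<omega> k)"
    and "y = C (x + \<omega> i + \<omega> k)" and "z = C x"
  have "z + p = q + y" "z + q = p + y"
    using relation[OF i k] relation[OF k i] by (simp_all add: p_def q_def y_def z_def swap)
  then have "(z + p) + (z + q) = (q + y) + (p + y)" by simp
  then have "2 *\<^sub>R z = 2 *\<^sub>R y" by (simp add: scaleR_2 algebra_simps)
  then show ?thesis by (simp add: y_def z_def)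
qed

theorem mainTheorem2:
  fixes m :: nat
    and \<omega> w :: "nat \<Rightarrow> 'n::{finite,linorder} clifford"
    and C :: "'n clifford \<Rightarrow> 'n clifford"
  assumes dim: "CARD('n) = 2 * m + 1"
    and half_periods: "\<And>j. j \<in> {1..2 * m + 2} \<Longrightarrow> \<omega> j \<in> paravectors"
    and indep: "inj_on \<omega> {1..2 * m + 2}" "independent (\<omega> ` {1..2 * m + 2})"
    and enum: "lattice_enumeration w (int_span (2 * m + 2) (\<lambda>j. 2 *\<^sub>R \<omega> j))"
  defines "C \<equiv> prod_id_minus_shift (2 * m + 2) \<omega> (weierstrass_zeta (2 * m + 2) w)"
  shows "\<forall>k \<in> {1..2 * m + 2}. \<forall>i \<in> {1..2 * m + 2}.
           \<forall>x \<in> paravectors - int_span (2 * m + 2) \<omega>. C (x + \<omega> i + \<omega> k) = C x"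
  unfolding C_def
  using prod_id_minus_shift_zeta_periods[OF half_periods indep enum] by blast

end
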